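(* Let $K\ge 2$ be an integer and let $M_K(e_1,\dots,e_K):=(e_1+\dots+e_K)/K$ for $(e_1,\dots,e_K)\in[0,\infty)^K$. Suppose that $F:[0,\infty)^K\to[0,\infty)$ is a symmetric e-merging function. Then $F$ is dominated by the function $\lambda+(1-\lambda)M_K$ for some $\lambda\in[0,1]$. In particular, $F$ is admissible if and only if $F=\lambda+(1-\lambda)M_K$, where $\lambda=F(\mathbf{0})\in[0,1]$ and $\mathbf{0}=(0,\dots,0)$.
   Context: For a probability space $(\Omega,\mathcal{A},Q)$, an e-variable is a measurable function $E:\Omega\to[0,\infty]$ with $\mathbb{E}^Q[E]\le 1$. An e-merging function (of $K$ e-values) is a Borel function $F:[0,\infty)^K\to[0,\infty)$ that is increasing ($\mathbf{e}\le\mathbf{e}'$ componentwise implies $F(\mathbf{e})\le F(\mathbf{e}')$) and such that, for every probability space $(\Omega,\mathcal{A},Q)$ and all e-variables $E_1,\dots,E_K$ on it taking values in $[0,\infty)$ (with arbitrary joint distribution), $F(E_1,\dots,E_K)$ is an e-variable. $F$ is symmetric if it is invariant under permutations of its arguments. $F$ dominates $G$ (equivalently, $G$ is dominated by $F$) if $F(\mathbf{e})\ge G(\mathbf{e})$ for all $\mathbf{e}\in[0,\infty)^K$; the domination is strict if in addition $F(\mathbf{e})>G(\mathbf{e})$ for some $\mathbf{e}\in[0,\infty)^K$. An e-merging function is admissible if it is not strictly dominated by any e-merging function (symmetric or not). *)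

theory Defs
  imports "HOL-Probability.Probability"
begin

definition e_variable :: "'a measure \<Rightarrow> ('a \<Rightarrow> ennreal) \<Rightarrow> bool" where
  "e_variable Q E \<longleftrightarrow> E \<in> borel_measurable Q \<and> (\<integral>\<^sup>+\<omega>. E \<omega> \<partial>Q) \<le> 1"

text \<open>
  A function from the orthant of nonnegative vectors to the nonnegative reals is represented by
  a total function \<open>F :: real ^ 'k \<Rightarrow> real\<close>, all of whose properties below only concern its
  values on \<open>{0..}\<close> (the order on \<open>real ^ 'k\<close> is componentwise, and \<open>K = CARD('k)\<close>).
  The real-valued families \<open>E\<close> below are the e-variables with values in \<open>[0, \<infinity>)\<close>;
  they have an arbitrary joint distribution.
\<close>

definition merges_on :: "'a measure \<Rightarrow> (real ^ 'k \<Rightarrow> real) \<Rightarrow> bool" where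
  "merges_on Q F \<longleftrightarrow>
     (\<forall>E :: 'k \<Rightarrow> 'a \<Rightarrow> real.
        (\<forall>k. (\<forall>\<omega>\<in>space Q. 0 \<le> E k \<omega>) \<and> e_variable Q (\<lambda>\<omega>. ennreal (E k \<omega>)))
        \<longrightarrow> e_variable Q (\<lambda>\<omega>. ennreal (F (\<chi> k. E k \<omega>))))"

text \<open>
  A definition in HOL cannot quantify over the types of the sample spaces. Here \<open>Q\<close> ranges over
  all probability spaces (with any \<open>\<sigma>\<close>-algebra) on subsets of \<open>real ^ 'k\<close>; lemma
  \<open>e_merging_merges_on\<close> below shows that this yields the property for the probability spaces
  over every type.
\<close>

definition e_merging :: "(real ^ 'k \<Rightarrow> real) \<Rightarrow> bool" where
  "e_merging F \<longleftrightarrow>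
     F \<in> borel_measurable (restrict_space borel {0..}) \<and>
     (\<forall>e\<in>{0..}. 0 \<le> F e) \<and>
     mono_on {0..} F \<and>
     (\<forall>Q :: (real ^ 'k) measure. prob_space Q \<longrightarrow> merges_on Q F)"

lemma e_merging_merges_on:
  fixes F :: "real ^ 'k \<Rightarrow> real" and Q :: "'a measure"
  assumes F: "e_merging F" and Q: "prob_space Q"
  shows "merges_on Q F"
  unfolding merges_on_def
proof (intro allI impI)
  fix E :: "'k \<Rightarrow> 'a \<Rightarrow> real"
  assume E: "\<forall>k. (\<forall>\<omega>\<in>space Q. 0 \<le> E k \<omega>) \<and> e_variable Q (\<lambda>\<omega>. ennreal (E k \<omega>))"
  define X where "X \<omega> = (\<chi> k. E k \<omega>)" for \<omega>
  define B where "B = restrict_space borel {0 :: real ^ 'k..}"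
  define N where "N = distr Q B X"
  have Ek: "E k \<in> borel_measurable Q" for k
  proof -
    have "(\<lambda>\<omega>. enn2real (ennreal (E k \<omega>))) \<in> borel_measurable Q"
      using E unfolding e_variable_def by (intro measurable_compose[OF _ borel_measurable_enn2real]) auto
    then show ?thesis
      by (subst measurable_cong[of _ _ "\<lambda>\<omega>. enn2real (ennreal (E k \<omega>))"]) (use E in auto)
  qed
  have "X \<in> borel_measurable Q"
    by (rule borel_measurable_euclidean_space[THEN iffD2])
       (auto simp: X_def Basis_vec_def inner_axis Ek)
  then have X: "X \<in> measurable Q B"
    unfolding B_def using E
    by (intro measurable_restrict_space2) (auto simp: X_def less_eq_vec_def)
  have FB: "F \<in> borel_measurable B"
    using F by (simp add: e_merging_def B_def)
  have coord: "(\<lambda>v :: real ^ 'k. ennreal (v $ k)) \<in> borel_measurable B" for k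
    unfolding B_def by (intro measurable_restrict_space1) measurable
  have "prob_space N"
    unfolding N_def by (rule prob_space.prob_space_distr[OF Q X])
  then have "merges_on N F"
    using F by (simp add: e_merging_def)
  moreover have "(\<forall>v\<in>space N. 0 \<le> v $ k) \<and> e_variable N (\<lambda>v. ennreal (v $ k))" for k
  proof -
    have "(\<integral>\<^sup>+v. ennreal (v $ k) \<partial>N) = (\<integral>\<^sup>+\<omega>. ennreal (E k \<omega>) \<partial>Q)"
      unfolding N_def using X coord by (subst nn_integral_distr) (simp_all add: X_def)
    moreover have "\<forall>v\<in>space N. 0 \<le> v $ k"
      by (simp add: N_def B_def space_restrict_space less_eq_vec_def)
    moreover have "(\<lambda>v. ennreal (v $ k)) \<in> borel_measurable N"
      unfolding N_def using coord by simp
    ultimately show ?thesis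
      using E by (auto simp: e_variable_def)
  qed
  ultimately have "e_variable N (\<lambda>v. ennreal (F (\<chi> k. v $ k)))"
    unfolding merges_on_def by (elim allE[of _ "\<lambda>k v. v $ k"]) auto
  then have "e_variable N (\<lambda>v. ennreal (F v))"
    by simp
  moreover have FM: "(\<lambda>v. ennreal (F v)) \<in> borel_measurable B"
    using FB by measurable
  ultimately show "e_variable Q (\<lambda>\<omega>. ennreal (F (\<chi> k. E k \<omega>)))"
    using measurable_compose[OF X FM]
    using X FM by (simp add: e_variable_def N_def nn_integral_distr X_def[symmetric])
qed

definition symmetric_fun :: "(real ^ 'k \<Rightarrow> real) \<Rightarrow> bool" where
  "symmetric_fun F \<longleftrightarrow> (\<forall>\<pi>. \<pi> permutes UNIV \<longrightarrow> (\<forall>e\<in>{0..}. F (\<chi> k. e $ \<pi> k) = F e))"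

definition dominates :: "(real ^ 'k \<Rightarrow> real) \<Rightarrow> (real ^ 'k \<Rightarrow> real) \<Rightarrow> bool" where
  "dominates F G \<longleftrightarrow> (\<forall>e\<in>{0..}. G e \<le> F e)"

definition strictly_dominates :: "(real ^ 'k \<Rightarrow> real) \<Rightarrow> (real ^ 'k \<Rightarrow> real) \<Rightarrow> bool" where
  "strictly_dominates F G \<longleftrightarrow> dominates F G \<and> (\<exists>e\<in>{0..}. G e < F e)"

definition admissible :: "(real ^ 'k \<Rightarrow> real) \<Rightarrow> bool" where
  "admissible F \<longleftrightarrow> e_merging F \<and> \<not> (\<exists>G. e_merging G \<and> strictly_dominates G F)"

definition arith_mean :: "real ^ 'k \<Rightarrow> real" where
  "arith_mean e = (\<Sum>k\<in>UNIV. e $ k) / real CARD('k)"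

end

theory Submission
  imports Defs
begin

text \<open>
  Merging by a symmetric \<open>F\<close> is merging of a single e-variable. Draw a vector at random and then
  shuffle its coordinates by an independent uniform permutation: every coordinate of the result
  has expectation equal to the expected arithmetic mean of the drawn vector, whereas a symmetric
  \<open>F\<close> does not notice the shuffling. Hence the expectation of \<open>F\<close> is at most \<open>1\<close> under every
  law under which the arithmetic mean \<open>M\<close> has expectation at most \<open>1\<close>. Laws with two atoms
  suffice (\<open>e_merging_two_point\<close>).

  Apply this to atoms \<open>x\<close> and \<open>y\<close> with \<open>M x < 1 < M y\<close>, weighted so that the mean is \<open>1\<close>. The
  result says that the slope of the chord from \<open>(1, 1)\<close> to \<open>(M y, F y)\<close> is at most the slope of
  the chord from \<open>(M x, F x)\<close> to \<open>(1, 1)\<close>. So a line through \<open>(1, 1)\<close> fits between the two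
  families of slopes. It lies on or above all points \<open>(M e, F e)\<close>, since those with \<open>M e = 1\<close>
  have \<open>F e \<le> 1\<close>. This line is the dominating function \<open>l + (1 - l) * M\<close>, where \<open>1 - l\<close> is the
  infimum of the slopes on the left.

  An affine function of the mean with slope in \<open>[0, 1]\<close> that takes the value \<open>1\<close> at mean \<open>1\<close> is
  itself e-merging, so an admissible \<open>F\<close> has to be equal to the function that dominates it.
  Conversely, such an affine function is admissible because it has expectation exactly \<open>1\<close> under
  every shuffled law of mean \<open>1\<close>: a function \<open>G\<close>, symmetric or not, that is larger everywhere and
  strictly larger at some \<open>e\<close> would have an expectation above \<open>1\<close> under a law of mean \<open>1\<close> that
  charges \<open>e\<close>.
\<close>

section \<open>Averaging over permutations of the coordinates\<close>

definition permute_vec :: "('k \<Rightarrow> 'k) \<Rightarrow> real ^ 'k \<Rightarrow> real ^ 'k" where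
  "permute_vec \<pi> e = (\<chi> k. e $ \<pi> k)"

definition perm_mean :: "(real ^ 'k \<Rightarrow> real) \<Rightarrow> real ^ 'k \<Rightarrow> real" where
  "perm_mean F e = (\<Sum>\<pi> | \<pi> permutes UNIV. F (permute_vec \<pi> e)) / fact CARD('k)"

lemma card_permutes_UNIV: "card {\<pi> :: 'k :: finite \<Rightarrow> 'k. \<pi> permutes UNIV} = fact CARD('k)"
  by (rule card_permutations) auto

lemma permutes_UNIV_nonempty: "{\<pi> :: 'k \<Rightarrow> 'k. \<pi> permutes UNIV} \<noteq> {}"
  using permutes_id by blast

lemma permute_vec_nonneg: "0 \<le> e \<Longrightarrow> 0 \<le> permute_vec \<pi> e"
  by (simp add: permute_vec_def less_eq_vec_def)

lemma permute_vec_id [simp]: "permute_vec id e = e"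
  by (simp add: permute_vec_def vec_eq_iff)

lemma arith_mean_nonneg: "0 \<le> e \<Longrightarrow> 0 \<le> arith_mean e"
  by (simp add: arith_mean_def less_eq_vec_def sum_nonneg)

lemma arith_mean_mono: "e \<le> e' \<Longrightarrow> arith_mean e \<le> arith_mean e'"
  by (simp add: arith_mean_def less_eq_vec_def sum_mono divide_right_mono)

lemma arith_mean_const [simp]: "arith_mean (\<chi> k. c) = c"
  by (simp add: arith_mean_def)

lemma arith_mean_zero [simp]: "arith_mean 0 = 0"
  by (simp add: arith_mean_def)

lemma arith_mean_permute_vec:
  assumes "\<pi> permutes UNIV"
  shows "arith_mean (permute_vec \<pi> e) = arith_mean e"
  using sum.permute[OF assms, of "\<lambda>k. e $ k"] by (simp add: arith_mean_def permute_vec_def o_def)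

lemma perm_mean_symmetric:
  assumes "symmetric_fun F" "0 \<le> e"
  shows "perm_mean F e = F e"
proof -
  have "(\<Sum>\<pi> | \<pi> permutes UNIV. F (permute_vec \<pi> e)) = (\<Sum>\<pi> :: 'a \<Rightarrow> 'a | \<pi> permutes UNIV. F e)"
    using assms by (intro sum.cong) (auto simp: symmetric_fun_def permute_vec_def)
  then show ?thesis
    by (simp add: perm_mean_def card_permutes_UNIV)
qed

text \<open>
  Composing with a transposition shows that the sum over all permutations does not depend on the
  coordinate \<open>k\<close>; so it is the average over \<open>k\<close> of these sums, and exchanging the two sums
  leaves the sum of all coordinates for every permutation.
\<close>
lemma perm_mean_coordinate:
  fixes e :: "real ^ 'k"
  shows "perm_mean (\<lambda>v. v $ k) e = arith_mean e"
proof -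
  define S where "S j = (\<Sum>\<pi> :: 'k \<Rightarrow> 'k | \<pi> permutes UNIV. e $ \<pi> j)" for j
  have S: "S j = S k" for j
  proof -
    have "Transposition.transpose j k permutes UNIV"
      by (rule permutes_swap_id) auto
    from sum_permutations_compose_right[OF this, of "\<lambda>\<pi>. e $ \<pi> j"]
    show ?thesis
      by (simp add: S_def)
  qed
  have "real CARD('k) * S k = (\<Sum>j\<in>(UNIV :: 'k set). S k)"
    by simp
  also have "\<dots> = (\<Sum>j\<in>UNIV. S j)"
    by (rule sum.cong[OF refl S[symmetric]])
  also have "\<dots> = (\<Sum>\<pi> :: 'k \<Rightarrow> 'k | \<pi> permutes UNIV. \<Sum>j\<in>UNIV. e $ \<pi> j)"
    unfolding S_def by (rule sum.swap)
  also have "\<dots> = (\<Sum>\<pi> :: 'k \<Rightarrow> 'k | \<pi> permutes UNIV. \<Sum>j\<in>UNIV. e $ j)"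
    by (intro sum.cong refl sum.permute[where g = "\<lambda>j. e $ j", unfolded o_def, symmetric]) simp
  also have "\<dots> = fact CARD('k) * (\<Sum>j\<in>UNIV. e $ j)"
    by (simp add: card_permutes_UNIV)
  finally show ?thesis
    by (simp add: perm_mean_def permute_vec_def arith_mean_def S_def field_simps)
qed

lemma perm_mean_mono:
  assumes "\<And>v. 0 \<le> v \<Longrightarrow> F v \<le> G v" "0 \<le> e"
  shows "perm_mean F e \<le> perm_mean G e"
  unfolding perm_mean_def using assms permute_vec_nonneg
  by (intro divide_right_mono sum_mono) auto

lemma perm_mean_strict_mono:
  assumes "\<And>v. 0 \<le> v \<Longrightarrow> F v \<le> G v" "0 \<le> e" "F e < G e"
  shows "perm_mean F e < perm_mean G e"
  unfolding perm_mean_def using assms permute_vec_nonneg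
  by (intro divide_strict_right_mono sum_strict_mono_ex1 bexI[of _ id]) (auto simp: permutes_id)

lemma perm_mean_affine_mean:
  fixes e :: "real ^ 'k"
  shows "perm_mean (\<lambda>e. l + (1 - l) * arith_mean e) e = l + (1 - l) * arith_mean e"
  by (simp add: perm_mean_def arith_mean_permute_vec card_permutes_UNIV)

section \<open>Shuffled laws with two atoms\<close>

lemma nn_integral_shuffled_two_point:
  fixes x y :: "real ^ 'k"
  assumes p: "p \<in> {0..1}" and "0 \<le> x" "0 \<le> y" and F: "\<And>e. 0 \<le> e \<Longrightarrow> 0 \<le> F e"
  shows "(\<integral>\<^sup>+(b, \<pi>). ennreal (F (permute_vec \<pi> (if b then x else y)))
            \<partial>measure_pmf (pair_pmf (bernoulli_pmf p) (pmf_of_set {\<pi>. \<pi> permutes UNIV})))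
         = ennreal (p * perm_mean F x + (1 - p) * perm_mean F y)"
proof -
  have inner: "(\<integral>\<^sup>+\<pi>. ennreal (F (permute_vec \<pi> e)) \<partial>measure_pmf (pmf_of_set {\<pi>. \<pi> permutes UNIV}))
       = ennreal (perm_mean F e)" if "0 \<le> e" for e :: "real ^ 'k"
    using F permute_vec_nonneg[OF that]
    by (simp add: nn_integral_pmf_of_set[OF permutes_UNIV_nonempty]
        card_permutes_UNIV perm_mean_def sum_nonneg divide_ennreal ennreal_of_nat_eq_real_of_nat)
  have "0 \<le> perm_mean F e" if "0 \<le> e" for e
    unfolding perm_mean_def by (intro divide_nonneg_nonneg sum_nonneg F permute_vec_nonneg that) auto
  then show ?thesis
    using assms
    by (simp add: nn_integral_pair_pmf' inner ennreal_mult' mult.commute)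
qed

text \<open>
  The sample space is a coin that selects \<open>x\<close> or \<open>y\<close>, together with an independent uniform
  permutation; the e-variables are the coordinates of the shuffled selected vector.
\<close>
lemma e_merging_two_point:
  fixes F :: "real ^ 'k \<Rightarrow> real"
  assumes F: "e_merging F" and p: "p \<in> {0..1}" and x: "0 \<le> x" and y: "0 \<le> y"
    and mean: "p * arith_mean x + (1 - p) * arith_mean y \<le> 1"
  shows "p * perm_mean F x + (1 - p) * perm_mean F y \<le> 1"
proof -
  define Q where "Q = measure_pmf (pair_pmf (bernoulli_pmf p) (pmf_of_set {\<pi> :: 'k \<Rightarrow> 'k. \<pi> permutes UNIV}))"
  define X where "X = (\<lambda>(b, \<pi>). permute_vec \<pi> (if b then x else y))"
  have int: "(\<integral>\<^sup>+\<omega>. ennreal (G (X \<omega>)) \<partial>Q) = ennreal (p * perm_mean G x + (1 - p) * perm_mean G y)"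
    if "\<And>e. 0 \<le> e \<Longrightarrow> 0 \<le> G e" for G
    using nn_integral_shuffled_two_point[where F = G, OF p x y that]
    by (simp add: Q_def X_def case_prod_beta')
  have "prob_space Q"
    unfolding Q_def by (rule prob_space_measure_pmf)
  then have "merges_on Q F"
    by (rule e_merging_merges_on[OF F])
  moreover have "(\<forall>\<omega>\<in>space Q. 0 \<le> X \<omega> $ k) \<and> e_variable Q (\<lambda>\<omega>. ennreal (X \<omega> $ k))" for k
  proof -
    have "0 \<le> X \<omega> $ k" for \<omega>
      using x y by (auto simp: X_def permute_vec_def less_eq_vec_def split: prod.split)
    moreover have "(\<integral>\<^sup>+\<omega>. ennreal (X \<omega> $ k) \<partial>Q) \<le> 1"
      using mean by (subst int) (auto simp: less_eq_vec_def perm_mean_coordinate)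
    ultimately show ?thesis
      by (simp add: e_variable_def Q_def)
  qed
  ultimately have "e_variable Q (\<lambda>\<omega>. ennreal (F (\<chi> k. X \<omega> $ k)))"
    unfolding merges_on_def by (elim allE[of _ "\<lambda>k \<omega>. X \<omega> $ k"]) auto
  then have "(\<integral>\<^sup>+\<omega>. ennreal (F (X \<omega>)) \<partial>Q) \<le> 1"
    by (simp add: e_variable_def)
  then show ?thesis
    using F by (subst (asm) int) (auto simp: e_merging_def)
qed

section \<open>Domination by an affine function of the mean\<close>

lemma e_merging_affine_mean:
  assumes l: "l \<in> {0..1}"
  shows "e_merging (\<lambda>e :: real ^ 'k. l + (1 - l) * arith_mean e)"
  unfolding e_merging_def
proof (intro conjI allI impI ballI)
  show "(\<lambda>e :: real ^ 'k. l + (1 - l) * arith_mean e) \<in> borel_measurable (restrict_space borel {0..})"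
    unfolding arith_mean_def by (intro measurable_restrict_space1) measurable
  show "0 \<le> l + (1 - l) * arith_mean e" if "e \<in> {0..}" for e :: "real ^ 'k"
    using l that arith_mean_nonneg[of e] by simp
  show "mono_on {0..} (\<lambda>e :: real ^ 'k. l + (1 - l) * arith_mean e)"
    using l by (intro mono_onI add_left_mono mult_left_mono arith_mean_mono) auto
  fix Q :: "(real ^ 'k) measure"
  assume "prob_space Q"
  then interpret prob_space Q .
  show "merges_on Q (\<lambda>e :: real ^ 'k. l + (1 - l) * arith_mean e)"
    unfolding merges_on_def
  proof (intro allI impI)
    fix E :: "'k \<Rightarrow> real ^ 'k \<Rightarrow> real"
    assume E: "\<forall>k. (\<forall>\<omega>\<in>space Q. 0 \<le> E k \<omega>) \<and> e_variable Q (\<lambda>\<omega>. ennreal (E k \<omega>))"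
    define c where "c = (1 - l) / real CARD('k)"
    have c: "0 \<le> c"
      using l by (simp add: c_def)
    let ?H = "\<lambda>\<omega>. ennreal l + ennreal c * (\<Sum>k\<in>UNIV. ennreal (E k \<omega>))"
    have meas [measurable]: "(\<lambda>\<omega>. ennreal (E k \<omega>)) \<in> borel_measurable Q" for k
      using E by (simp add: e_variable_def)
    have H: "ennreal (l + (1 - l) * arith_mean (\<chi> k. E k \<omega>)) = ?H \<omega>" if "\<omega> \<in> space Q" for \<omega>
    proof -
      have "l + (1 - l) * arith_mean (\<chi> k. E k \<omega>) = l + c * (\<Sum>k\<in>UNIV. E k \<omega>)"
        by (simp add: arith_mean_def c_def)
      then show ?thesis
        using E that l c by (simp add: ennreal_plus ennreal_mult sum_nonneg)
    qed
    have "(\<integral>\<^sup>+\<omega>. ?H \<omega> \<partial>Q) = ennreal l + ennreal c * (\<Sum>k\<in>UNIV. \<integral>\<^sup>+\<omega>. ennreal (E k \<omega>) \<partial>Q)"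
      by (simp add: nn_integral_add nn_integral_cmult nn_integral_sum emeasure_space_1)
    also have "\<dots> \<le> ennreal l + ennreal c * (\<Sum>k\<in>(UNIV :: 'k set). 1)"
      using E by (intro add_left_mono mult_left_mono sum_mono) (auto simp: e_variable_def)
    also have "\<dots> = ennreal (l + c * real CARD('k))"
      using l c by (simp add: ennreal_plus ennreal_mult ennreal_of_nat_eq_real_of_nat)
    also have "l + c * real CARD('k) = 1"
      by (simp add: c_def)
    finally have "(\<integral>\<^sup>+\<omega>. ?H \<omega> \<partial>Q) \<le> 1"
      by simp
    moreover have "?H \<in> borel_measurable Q"
      by measurable
    ultimately show "e_variable Q (\<lambda>\<omega>. ennreal (l + (1 - l) * arith_mean (\<chi> k. E k \<omega>)))"
      unfolding e_variable_def
      using H by (simp cong: measurable_cong nn_integral_cong_simp)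
  qed
qed

lemma symmetric_e_merging_le_1:
  assumes "e_merging F" "symmetric_fun F" "0 \<le> e" "arith_mean e \<le> 1"
  shows "F e \<le> 1"
  using e_merging_two_point[of F 1 e e] assms by (simp add: perm_mean_symmetric)

text \<open>
  The weights \<open>(M y - 1) / (M y - M x)\<close> and \<open>(1 - M x) / (M y - M x)\<close> are those that give the
  law on \<open>x\<close> and \<open>y\<close> the mean \<open>1\<close>.
\<close>
lemma symmetric_e_merging_chord_slopes:
  assumes F: "e_merging F" "symmetric_fun F" and x: "0 \<le> x" "arith_mean x < 1"
    and y: "0 \<le> y" "1 < arith_mean y"
  shows "(F y - 1) / (arith_mean y - 1) \<le> (1 - F x) / (1 - arith_mean x)"
proof -
  let ?a = "arith_mean x" and ?b = "arith_mean y"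
  define p where "p = (?b - 1) / (?b - ?a)"
  have q: "1 - p = (1 - ?a) / (?b - ?a)" and p: "p \<in> {0..1}"
    using x y by (auto simp: p_def field_simps)
  have "p * ?a + (1 - p) * ?b = ((?b - 1) * ?a + (1 - ?a) * ?b) / (?b - ?a)"
    unfolding q by (simp add: p_def add_divide_distrib)
  also have "\<dots> = 1"
    using x y by (simp add: field_simps)
  finally have "p * F x + (1 - p) * F y \<le> 1"
    using e_merging_two_point[OF F(1) p x(1) y(1)] x y F by (simp add: perm_mean_symmetric)
  then have "((?b - 1) * F x + (1 - ?a) * F y) / (?b - ?a) \<le> 1"
    unfolding q by (simp add: p_def add_divide_distrib)
  then have "(?b - 1) * F x + (1 - ?a) * F y \<le> ?b - ?a"
    using x y by (simp add: divide_le_eq)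
  then show ?thesis
    using x y by (simp add: field_simps)
qed

text \<open>
  The slope \<open>s\<close> of the line is the infimum of the slopes on the left because that choice puts it
  in \<open>[0, 1]\<close> at once: \<open>F \<le> 1\<close> at vectors of mean below \<open>1\<close> makes all these slopes nonnegative,
  and the slope at the zero vector is \<open>1 - F 0 \<le> 1\<close>.
\<close>
lemma symmetric_e_merging_dominated:
  assumes F: "e_merging F" "symmetric_fun F"
  shows "\<exists>l\<in>{0..1}. dominates (\<lambda>e. l + (1 - l) * arith_mean e) F"
proof -
  define A where "A = {e :: real ^ 'a. 0 \<le> e \<and> arith_mean e < 1}"
  define slope where "slope e = (1 - F e) / (1 - arith_mean e)" for e
  define s where "s = (INF e\<in>A. slope e)"
  have zero: "0 \<in> A"
    by (simp add: A_def)
  then have A: "A \<noteq> {}"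
    by blast
  have slope_nonneg: "0 \<le> slope e" if "e \<in> A" for e
    using that symmetric_e_merging_le_1[OF F, of e] by (auto simp: A_def slope_def)
  have s_le: "s \<le> slope e" if "e \<in> A" for e
    unfolding s_def using that slope_nonneg by (intro cINF_lower bdd_belowI2[where m = 0]) auto
  have "0 \<le> s"
    unfolding s_def using A slope_nonneg by (intro cINF_greatest) auto
  moreover have "slope 0 \<le> 1"
    using F by (simp add: slope_def e_merging_def)
  ultimately have s: "s \<in> {0..1}"
    using s_le[OF zero] by auto
  have "F e \<le> 1 + s * (arith_mean e - 1)" if e: "0 \<le> e" for e
  proof (cases "arith_mean e" "1 :: real" rule: linorder_cases)
    case less
    then have "s \<le> (1 - F e) / (1 - arith_mean e)"
      using s_le[of e] e by (simp add: A_def slope_def)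
    then show ?thesis
      using less by (simp add: field_simps)
  next
    case equal
    then show ?thesis
      using symmetric_e_merging_le_1[OF F e] by simp
  next
    case greater
    have "(F e - 1) / (arith_mean e - 1) \<le> s"
      unfolding s_def slope_def using A symmetric_e_merging_chord_slopes[OF F _ _ e greater]
      by (intro cINF_greatest) (auto simp: A_def)
    then show ?thesis
      using greater by (simp add: field_simps)
  qed
  then have "dominates (\<lambda>e. (1 - s) + (1 - (1 - s)) * arith_mean e) F"
    by (simp add: dominates_def algebra_simps)
  then show ?thesis
    using s by (intro bexI[of _ "1 - s"]) auto
qed

section \<open>Admissibility\<close>

text \<open>
  Whatever the mean of the vector \<open>e\<close> is, mixing \<open>e\<close> with the zero vector (if that mean is at
  least \<open>1\<close>) or with the constant vector \<open>2\<close> (otherwise) yields a law of mean \<open>1\<close> that charges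
  \<open>e\<close>.
\<close>
lemma affine_mean_not_strictly_dominated:
  fixes G :: "real ^ 'k \<Rightarrow> real"
  assumes G: "e_merging G"
  shows "\<not> strictly_dominates G (\<lambda>e. l + (1 - l) * arith_mean e)"
proof
  let ?H = "\<lambda>e :: real ^ 'k. l + (1 - l) * arith_mean e"
  assume "strictly_dominates G ?H"
  then obtain e where le: "\<And>v. 0 \<le> v \<Longrightarrow> ?H v \<le> G v" and e: "0 \<le> e" "?H e < G e"
    by (auto simp: strictly_dominates_def dominates_def)
  obtain p c where p: "0 < p" "p \<le> 1" and c: "0 \<le> (c :: real)" and mean: "p * arith_mean e + (1 - p) * c = 1"
  proof (cases "1 \<le> arith_mean e")
    case True
    then show ?thesis
      by (intro that[of "1 / arith_mean e" 0]) auto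
  next
    case False
    define p where "p = 1 / (2 - arith_mean e)"
    have "p * (2 - arith_mean e) = 1" "0 < p" "p \<le> 1"
      using False by (auto simp: p_def)
    then show ?thesis
      by (intro that[of p 2]) (auto simp: algebra_simps)
  qed
  define y :: "real ^ 'k" where "y = (\<chi> k. c)"
  have y: "0 \<le> y" and My: "arith_mean y = c"
    using c by (auto simp: y_def less_eq_vec_def)
  have "1 = l + (1 - l) * (p * arith_mean e + (1 - p) * c)"
    by (simp add: mean)
  also have "\<dots> = p * ?H e + (1 - p) * ?H y"
    by (simp add: My algebra_simps)
  also have "\<dots> = p * perm_mean ?H e + (1 - p) * perm_mean ?H y"
    by (simp add: perm_mean_affine_mean)
  also have "\<dots> < p * perm_mean G e + (1 - p) * perm_mean G y"
    using p perm_mean_strict_mono[of ?H G, OF le e] perm_mean_mono[of ?H G, OF le y]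
    by (intro add_less_le_mono mult_strict_left_mono mult_left_mono) auto
  also have "\<dots> \<le> 1"
    using p mean by (intro e_merging_two_point[OF G _ e(1) y]) (auto simp: My)
  finally show False
    by simp
qed

theorem theorem3p2:
  fixes F :: "real ^ 'k \<Rightarrow> real"
  assumes "CARD('k) \<ge> 2"
    and "e_merging F"
    and "symmetric_fun F"
  shows "(\<exists>l\<in>{0..1}. dominates (\<lambda>e. l + (1 - l) * arith_mean e) F) \<and>
         F 0 \<in> {0..1} \<and>
         (admissible F \<longleftrightarrow> (\<forall>e\<in>{0..}. F e = F 0 + (1 - F 0) * arith_mean e))"
proof (intro conjI)
  note F = assms(2,3)
  show ex: "\<exists>l\<in>{0..1}. dominates (\<lambda>e. l + (1 - l) * arith_mean e) F"
    by (rule symmetric_e_merging_dominated[OF F])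
  show "F 0 \<in> {0..1}"
    using symmetric_e_merging_le_1[OF F, of 0] F(1) by (auto simp: e_merging_def)
  show "admissible F \<longleftrightarrow> (\<forall>e\<in>{0..}. F e = F 0 + (1 - F 0) * arith_mean e)"
  proof
    assume adm: "admissible F"
    obtain l where l: "l \<in> {0..1}" and dom: "dominates (\<lambda>e. l + (1 - l) * arith_mean e) F"
      using ex by blast
    have eq: "F e = l + (1 - l) * arith_mean e" if "0 \<le> e" for e
      using adm e_merging_affine_mean[OF l] dom that
      by (force simp: admissible_def strictly_dominates_def dominates_def)
    have "F 0 = l"
      using eq[of 0] by simp
    then show "\<forall>e\<in>{0..}. F e = F 0 + (1 - F 0) * arith_mean e"
      using eq by simp
  next
    assume "\<forall>e\<in>{0..}. F e = F 0 + (1 - F 0) * arith_mean e"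
    then obtain l where "\<forall>e\<in>{0..}. F e = l + (1 - l) * arith_mean e"
      by blast
    then have "\<not> strictly_dominates G F" if "e_merging G" for G
      using affine_mean_not_strictly_dominated[OF that, of l]
      by (auto simp: strictly_dominates_def dominates_def)
    then show "admissible F"
      using F(1) by (auto simp: admissible_def)
  qed
qed

end
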